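(* Let $a>0$, $\delta>0$, let $\rho_1,\rho_2:(0,a)\to[\delta,1]$ be measurable, and set $m=\min\Big\{\int_0^a\rho_1\,dx,\ \int_0^a\rho_2\,dx\Big\}$. Then for every $k\in\mathbb{N}$, $$\mu_k(\rho_1,\rho_2)\le\frac{\pi^2k^2}{m^2}.$$
   Context: The functions $\rho_1,\rho_2$ are extended by $0$ to $\mathbb{R}$. For nonnegative $\rho_1,\rho_2\in L^1(\mathbb{R})\cap L^\infty(\mathbb{R})$ with $\rho_2\not\equiv0$ and an integer $k\ge0$, $$\mu_k(\rho_1,\rho_2):=\inf_{S}\ \max_{u\in S\setminus\{0\}}\frac{\int_{\mathbb{R}}\rho_1(u')^2dx}{\int_{\mathbb{R}}\rho_2u^2dx},$$ where $S$ ranges over the linear subspaces of $C_c^\infty(\mathbb{R})$ of dimension $k+1$ for which $\{u\cdot1_{\{\rho_2>0\}}:u\in S\}$ also has dimension $k+1$ (functions identified when equal a.e.). In the present situation this is the $k$-th eigenvalue ($k\ge 0$, counted with multiplicity) of $-(\rho_1u')'=\mu\rho_2u$ on $(0,a)$ with Neumann boundary conditions. *)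

theory Defs
  imports "HOL-Analysis.Analysis" "HOL-Library.Function_Algebras"
begin

instantiation "fun" :: (type, real_vector) real_vector
begin

definition "scaleR c f = (\<lambda>x. c *\<^sub>R f x)" for f :: "'a \<Rightarrow> 'b"

instance
  by standard (simp_all add: scaleR_fun_def fun_eq_iff scaleR_add_left scaleR_add_right)

end

lemma scaleR_fun_apply [simp]: "(c *\<^sub>R f) x = c *\<^sub>R f x"
  by (simp add: scaleR_fun_def)

text \<open>Real functions on the line modulo equality Lebesgue-almost everywhere.\<close>

definition ae_equal :: "(real \<Rightarrow> real) \<Rightarrow> (real \<Rightarrow> real) \<Rightarrow> bool" where
  "ae_equal f g \<longleftrightarrow> (AE x in lebesgue. f x = g x)"

quotient_type ae_fun = "real \<Rightarrow> real" / ae_equal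
  morphisms rep_ae_fun ae_class
proof (rule equivpI)
  show "reflp ae_equal"
    by (rule reflpI) (simp add: ae_equal_def)
  show "symp ae_equal"
    by (rule sympI) (auto simp: ae_equal_def)
  show "transp ae_equal"
    by (rule transpI) (auto simp: ae_equal_def)
qed

instantiation ae_fun :: real_vector
begin

lift_definition zero_ae_fun :: ae_fun is "0 :: real \<Rightarrow> real" .

lift_definition plus_ae_fun :: "ae_fun \<Rightarrow> ae_fun \<Rightarrow> ae_fun" is "(+) :: (real \<Rightarrow> real) \<Rightarrow> _"
  by (auto simp: ae_equal_def)

lift_definition uminus_ae_fun :: "ae_fun \<Rightarrow> ae_fun" is "uminus :: (real \<Rightarrow> real) \<Rightarrow> _"
  by (auto simp: ae_equal_def)

lift_definition minus_ae_fun :: "ae_fun \<Rightarrow> ae_fun \<Rightarrow> ae_fun" is "(-) :: (real \<Rightarrow> real) \<Rightarrow> _"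
  by (auto simp: ae_equal_def)

lift_definition scaleR_ae_fun :: "real \<Rightarrow> ae_fun \<Rightarrow> ae_fun" is "scaleR :: _ \<Rightarrow> (real \<Rightarrow> real) \<Rightarrow> _"
  by (auto simp: ae_equal_def)

instance
  by standard (transfer, simp add: ae_equal_def algebra_simps)+

end

definition test_functions :: "(real \<Rightarrow> real) set" where
  "test_functions =
    {u. (\<forall>n. (deriv ^^ n) u differentiable_on UNIV) \<and> compact (closure {x. u x \<noteq> 0})}"

definition rayleigh :: "(real \<Rightarrow> real) \<Rightarrow> (real \<Rightarrow> real) \<Rightarrow> (real \<Rightarrow> real) \<Rightarrow> real" where
  "rayleigh \<rho>1 \<rho>2 u =
    (LINT x|lebesgue. \<rho>1 x * (deriv u x)\<^sup>2) / (LINT x|lebesgue. \<rho>2 x * (u x)\<^sup>2)"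

text \<open>
  \<^const>\<open>dim\<close> is \<open>0\<close> on infinite-dimensional spaces, so \<open>dim S = k + 1\<close> forces finite
  dimension.
\<close>

definition admissible :: "nat \<Rightarrow> (real \<Rightarrow> real) \<Rightarrow> (real \<Rightarrow> real) set set" where
  "admissible k \<rho>2 =
    {S. S \<subseteq> test_functions \<and> subspace S \<and> dim S = k + 1 \<and>
        dim ((\<lambda>u. ae_class (\<lambda>x. u x * indicator {x. \<rho>2 x > 0} x)) ` S) = k + 1}"

text \<open>
  For \<open>S\<close> admissible and \<open>\<rho>1\<close>, \<open>\<rho>2\<close> nonnegative, integrable and essentially bounded, the
  denominator is positive on \<open>S - {0}\<close> and the quotient, being continuous and homogeneous of
  degree \<open>0\<close> there, attains its supremum. Hence the supremum below is a maximum.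
  Extended reals are used so that \<open>INF\<close> and \<open>SUP\<close> are the genuine infimum and supremum.
\<close>

definition mu :: "nat \<Rightarrow> (real \<Rightarrow> real) \<Rightarrow> (real \<Rightarrow> real) \<Rightarrow> ereal" where
  "mu k \<rho>1 \<rho>2 = (INF S \<in> admissible k \<rho>2. SUP u \<in> S - {0}. ereal (rayleigh \<rho>1 \<rho>2 u))"

definition zero_extend :: "real set \<Rightarrow> (real \<Rightarrow> real) \<Rightarrow> real \<Rightarrow> real" where
  "zero_extend A f x = (if x \<in> A then f x else 0)"

end

theory Submission
  imports Defs
begin

text \<open>
  Put \<open>M = \<integral> \<rho>2\<close> and \<open>\<theta> x = (\<pi> / M) \<integral>\<^sub>0\<^sup>x \<rho>2\<close>, which maps \<open>(0, a)\<close> onto \<open>(0, \<pi>)\<close>, and test with the span of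
  \<open>cos (j \<theta>)\<close>, \<open>j \<le> k\<close>. For \<open>u = V \<circ> \<theta>\<close> the bounds \<open>\<rho>1 \<le> 1\<close> and \<open>\<rho>2 \<le> 1\<close> give
  \<open>\<integral> \<rho>1 (u')\<^sup>2 \<le> (\<pi> / M) \<integral> (V')\<^sup>2\<close>, whereas \<open>\<integral> \<rho>2 u\<^sup>2 = (M / \<pi>) \<integral> V\<^sup>2\<close>, so the Rayleigh quotient is at
  most \<open>(\<pi> k / M)\<^sup>2\<close>. To obtain smooth test functions, \<open>\<rho>2\<close> is replaced in \<open>\<theta>\<close> by a polynomial with
  values in \<open>[0, 1]\<close> that is close to it in \<open>L\<^sup>1(0, a)\<close>, and \<open>u\<close> is multiplied by a cutoff equal to
  \<open>1\<close> on \<open>[0, a]\<close>. The error in the denominator is controlled because \<open>sup V\<^sup>2\<close> is at most a constant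
  depending on \<open>k\<close> times \<open>\<integral> V\<^sup>2\<close>.
\<close>

subsection \<open>Smooth functions and cutoffs\<close>

text \<open>Explicit witness derivatives turn each closure property into an induction on
  \<open>n\<close> over all functions at once. Nothing is said about continuity of the last
  derivative; \<open>smooth\<close> supplies it by quantifying over all \<open>n\<close>.\<close>

primrec ndiff :: "nat \<Rightarrow> (real \<Rightarrow> real) \<Rightarrow> bool" where
  "ndiff 0 f \<longleftrightarrow> True"
| "ndiff (Suc n) f \<longleftrightarrow> (\<exists>f'. (\<forall>x. (f has_real_derivative f' x) (at x)) \<and> ndiff n f')"

definition smooth :: "(real \<Rightarrow> real) \<Rightarrow> bool" where
  "smooth f \<longleftrightarrow> (\<forall>n. ndiff n f)"

lemma ndiff_SucI:
  assumes "\<And>x. (f has_real_derivative f' x) (at x)" "ndiff n f'"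
  shows "ndiff (Suc n) f"
  using assms by auto

lemma ndiff_Suc_imp: "ndiff (Suc n) f \<Longrightarrow> ndiff n f"
  by (induction n arbitrary: f) auto

lemma ndiff_const: "ndiff n (\<lambda>x. c)"
  by (induction n arbitrary: c) (auto intro!: exI[of _ "\<lambda>x. 0"])

lemma ndiff_add:
  assumes "ndiff n f" "ndiff n g" shows "ndiff n (\<lambda>x. f x + g x)"
  using assms
proof (induction n arbitrary: f g)
  case (Suc n)
  then obtain f' g' where "\<forall>x. (f has_real_derivative f' x) (at x)" "ndiff n f'"
    "\<forall>x. (g has_real_derivative g' x) (at x)" "ndiff n g'" by auto
  with Suc.IH show ?case
    by (intro ndiff_SucI[where f' = "\<lambda>x. f' x + g' x"]) (auto intro: DERIV_add)
qed simp

lemma ndiff_mult: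
  assumes "ndiff n f" "ndiff n g" shows "ndiff n (\<lambda>x. f x * g x)"
  using assms
proof (induction n arbitrary: f g)
  case (Suc n)
  then obtain f' g' where *: "\<forall>x. (f has_real_derivative f' x) (at x)" "ndiff n f'"
    "\<forall>x. (g has_real_derivative g' x) (at x)" "ndiff n g'" by auto
  have "ndiff n f" "ndiff n g" using Suc.prems ndiff_Suc_imp by blast+
  with * Suc.IH show ?case
    by (intro ndiff_SucI[where f' = "\<lambda>x. f' x * g x + g' x * f x"])
       (auto intro!: DERIV_mult ndiff_add)
qed simp

lemma ndiff_compose:
  assumes "ndiff n f" "ndiff n g" shows "ndiff n (\<lambda>x. f (g x))"
  using assms
proof (induction n arbitrary: f g)
  case (Suc n)
  then obtain f' g' where *: "\<forall>x. (f has_real_derivative f' x) (at x)" "ndiff n f'"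
    "\<forall>x. (g has_real_derivative g' x) (at x)" "ndiff n g'" by auto
  have "ndiff n g" using Suc.prems ndiff_Suc_imp by blast
  with * Suc.IH show ?case
    by (intro ndiff_SucI[where f' = "\<lambda>x. f' (g x) * g' x"])
       (auto intro!: DERIV_chain2[where f = f] ndiff_mult)
qed simp

lemma ndiff_cos_sin: "ndiff n cos" "ndiff n (sin :: real \<Rightarrow> real)"
proof (induction n)
  case (Suc n)
  { case 1
    have "ndiff n (\<lambda>x. (-1) * sin x)" by (rule ndiff_mult[OF ndiff_const Suc.IH(2)])
    then show ?case
      by (intro ndiff_SucI[where f' = "\<lambda>x. (-1) * sin x"]) (auto intro!: derivative_eq_intros)
  next
    case 2
    show ?case
      by (intro ndiff_SucI[where f' = cos] Suc.IH) (auto intro!: derivative_eq_intros) }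
qed auto

lemma ndiff_real_polynomial_function:
  assumes "real_polynomial_function p" shows "ndiff n p"
  using assms
proof (induction n arbitrary: p)
  case (Suc n)
  then show ?case using has_real_derivative_polynomial_function[OF Suc.prems] by auto
qed simp

text \<open>Passes from witness derivatives to the iterates of \<open>deriv\<close> used in
  \<open>test_functions\<close>: uniqueness of the derivative identifies \<open>deriv\<close> with
  the witness at each stage.\<close>

lemma smooth_imp_deriv_differentiable:
  assumes "smooth f" shows "(deriv ^^ n) f differentiable_on UNIV"
proof -
  have "smooth ((deriv ^^ n) f)"
  proof (induction n)
    case (Suc n)
    have "ndiff m (deriv ((deriv ^^ n) f))" for m
    proof -
      have "ndiff (Suc m) ((deriv ^^ n) f)" using Suc by (auto simp: smooth_def)
      then obtain f' where "\<forall>x. ((deriv ^^ n) f has_real_derivative f' x) (at x)" "ndiff m f'"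
        by auto
      moreover from this have "deriv ((deriv ^^ n) f) = f'" by (auto intro!: ext DERIV_imp_deriv)
      ultimately show ?thesis by simp
    qed
    then show ?case by (simp add: smooth_def)
  qed (use assms in simp)
  then have "ndiff (Suc 0) ((deriv ^^ n) f)" unfolding smooth_def by blast
  then show ?thesis
    by (meson ndiff.simps(2) differentiable_on_def differentiable_at_withinI real_differentiable_def)
qed

text \<open>For \<open>k = 0\<close> this is the classical smooth function exp(-1/x) glued to 0. The
  powers of 1/x make the family closed under differentiation up to linear combinations, which drives
  the induction in \<open>ndiff_flat\<close>.\<close>

definition flat :: "nat \<Rightarrow> real \<Rightarrow> real" where
  "flat k x = (if x > 0 then (1 / x) ^ k * exp (- (1 / x)) else 0)"

lemma flat_pos: "x > 0 \<Longrightarrow> flat k x > 0"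
  and flat_nonpos: "x \<le> 0 \<Longrightarrow> flat k x = 0"
  by (auto simp: flat_def)

lemma flat_tendsto_0: "(flat k \<longlongrightarrow> 0) (at 0)"
proof -
  have "((\<lambda>x::real. (1 / x) ^ k / exp (1 / x)) \<longlongrightarrow> 0) (at_right 0)"
    using filterlim_compose[OF tendsto_power_div_exp_0 filterlim_inverse_at_top_right]
    by (simp add: inverse_eq_divide)
  then have "(flat k \<longlongrightarrow> 0) (at_right 0)"
    by (rule tendsto_cong[THEN iffD1, rotated])
       (auto simp: flat_def exp_minus field_simps eventually_at_right_field intro: exI[of _ 1])
  moreover have "(flat k \<longlongrightarrow> 0) (at_left 0)"
    by (rule tendsto_eventually) (auto simp: flat_def eventually_at_left_field intro: exI[of _ "-1"])
  ultimately show ?thesis by (simp add: filterlim_split_at)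
qed

lemma flat_has_derivative:
  "(flat k has_real_derivative flat (k + 2) x + (- real k) * flat (k + 1) x) (at x)"
proof -
  consider "x > 0" | "x < 0" | "x = 0" by linarith
  then show ?thesis
  proof cases
    case 1
    have "((\<lambda>x. (1 / x) ^ k * exp (- (1 / x))) has_real_derivative
            flat (k + 2) x + (- real k) * flat (k + 1) x) (at x)"
    proof -
      define u where "u = 1 / x"
      have d: "((\<lambda>x. 1 / x) has_real_derivative - (u\<^sup>2)) (at x)"
        using 1 by (auto intro!: derivative_eq_intros simp: u_def power2_eq_square)
      have "((\<lambda>x. (1 / x) ^ k * exp (- (1 / x))) has_real_derivative
          real k * (- (u\<^sup>2) * u ^ (k - Suc 0)) * exp (- u) + exp (- u) * (- (- (u\<^sup>2))) * u ^ k) (at x)"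
        using DERIV_mult[OF DERIV_power[OF d, of k] DERIV_chain2[OF DERIV_exp DERIV_minus[OF d]]]
        by (simp add: u_def)
      moreover have "flat n x = u ^ n * exp (- u)" for n
        using 1 by (simp add: flat_def u_def)
      \<comment> \<open>The split on \<open>k\<close> is due to the truncated exponent
        \<open>k - Suc 0\<close>.\<close>
      ultimately show ?thesis
        by (cases k) (simp_all add: power2_eq_square algebra_simps)
    qed
    then show ?thesis
      by (rule has_field_derivative_transform_within_open[of _ _ _ "{0<..}"])
         (use 1 in \<open>auto simp: flat_def\<close>)
  next
    case 2
    have "((\<lambda>x. 0) has_real_derivative flat (k + 2) x + (- real k) * flat (k + 1) x) (at x)"
      using 2 by (simp add: flat_def)
    then show ?thesis
      by (rule has_field_derivative_transform_within_open[of _ _ _ "{..<0}"])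
         (use 2 in \<open>auto simp: flat_def\<close>)
  next
    case 3
    \<comment> \<open>The difference quotient at 0 is the next member of the family, whose limit at
      0 is 0. At \<open>h = 0\<close> the equation holds because division by zero gives 0.\<close>
    have "(\<lambda>h. (flat k (0 + h) - flat k 0) / h) = flat (Suc k)"
      by (auto simp: flat_def fun_eq_iff)
    then show ?thesis
      using 3 flat_tendsto_0[of "Suc k"] by (simp add: DERIV_def flat_nonpos)
  qed
qed

lemma ndiff_flat: "ndiff n (flat k)"
proof (induction n arbitrary: k)
  case (Suc n)
  show ?case
    by (rule ndiff_SucI[OF flat_has_derivative])
       (intro ndiff_add ndiff_mult ndiff_const Suc.IH)
qed simp

lemma smooth_cutoff:
  fixes a b :: real
  obtains w where "smooth w" "\<And>x. x \<in> {a..b} \<Longrightarrow> w x = 1"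
    "\<And>x. x \<notin> {a - 1..b + 1} \<Longrightarrow> w x = 0"
proof
  (* For t \<le> 0 the inner argument is \<le> 0, since flat 0 (1 - t) \<ge> exp (-1); for t \<ge> 1 it is constant. *)
  define s where "s t = flat 0 (exp (- 1) + (-1) * flat 0 (1 + (-1) * t))" for t
  define c where "c = flat 0 (exp (- 1))"
  \<comment> \<open>The first factor \<open>s\<close> is 0 for \<open>x \<le> a - 1\<close> and
    \<open>c\<close> for \<open>x \<ge> a\<close>; the second mirrors this at \<open>b\<close>.
    Writing \<open>(-1) * x\<close> lets \<open>ndiff_add\<close> and \<open>ndiff_mult\<close>
    apply.\<close>
  define w where "w x = (1 / c ^ 2) * (s (x + (1 - a)) * s (b + 1 + (-1) * x))" for x
  have c: "c > 0" unfolding c_def by (simp add: flat_pos)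
  have s1: "s t = c" if "t \<ge> 1" for t using that by (simp add: s_def c_def flat_nonpos)
  have s0: "s t = 0" if "t \<le> 0" for t
  proof -
    have "exp (-1) \<le> flat 0 (1 - t)" using that by (auto simp: flat_def)
    then show ?thesis by (simp add: s_def flat_nonpos)
  qed
  have id: "ndiff n (\<lambda>x. x)" for n
    by (rule ndiff_real_polynomial_function)
       (auto intro: real_polynomial_function.intros bounded_linear_ident)
  have s: "ndiff n s" for n
    unfolding s_def by (intro ndiff_compose[OF ndiff_flat] ndiff_add ndiff_mult ndiff_const id)
  show "smooth w" unfolding smooth_def w_def
    by (intro allI ndiff_mult ndiff_const ndiff_compose[OF s] ndiff_add id)
  show "w x = 1" if "x \<in> {a..b}" for x using that c by (simp add: w_def s1 power2_eq_square)
  show "w x = 0" if "x \<notin> {a - 1..b + 1}" for x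
    using that s0[of "x + (1 - a)"] s0[of "b + 1 + (-1) * x"] by (auto simp: w_def)
qed

subsection \<open>Orthogonality of cosines after a change of variable\<close>

text \<open>The integral of cos(j t)^2 over [0, pi].\<close>

definition cos_weight :: "nat \<Rightarrow> real" where
  "cos_weight j = (if j = 0 then pi else pi / 2)"

lemma cos_weight_pos: "cos_weight j > 0"
  by (simp add: cos_weight_def)

text \<open>For nonzero n the primitive sin(n \<theta>)/n vanishes at both ends, where \<theta> is 0
  and pi. The frequency is an integer so that both \<open>i - j\<close> and \<open>i + j\<close> are
  covered below.\<close>

lemma has_integral_deriv_cos:
  fixes \<theta> \<theta>' :: "real \<Rightarrow> real" and n :: int
  assumes "0 \<le> a" "\<And>x. (\<theta> has_real_derivative \<theta>' x) (at x)" "\<theta> 0 = 0" "\<theta> a = pi"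
  shows "((\<lambda>x. \<theta>' x * cos (of_int n * \<theta> x)) has_integral (if n = 0 then pi else 0)) {0..a}"
proof (cases "n = 0")
  case True
  have "(\<theta>' has_integral (\<theta> a - \<theta> 0)) {0..a}"
    by (rule fundamental_theorem_of_calculus)
       (use assms in \<open>auto simp: has_real_derivative_iff_has_vector_derivative
          intro: has_vector_derivative_at_within\<close>)
  then show ?thesis using True assms by simp
next
  case False
  have "((\<lambda>x. sin (of_int n * \<theta> x) / of_int n) has_real_derivative
          \<theta>' x * cos (of_int n * \<theta> x)) (at x)" for x
    using False by (auto intro!: derivative_eq_intros assms(2))
  then have "((\<lambda>x. \<theta>' x * cos (of_int n * \<theta> x)) has_integral
      (sin (of_int n * \<theta> a) / of_int n - sin (of_int n * \<theta> 0) / of_int n)) {0..a}"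
    by (intro fundamental_theorem_of_calculus)
       (use assms in \<open>auto simp: has_real_derivative_iff_has_vector_derivative
          intro: has_vector_derivative_at_within\<close>)
  moreover have "sin (of_int n * pi) = 0"
    by (metis sin_zero_iff_int2)
  ultimately show ?thesis using False assms by simp
qed

text \<open>Product-to-sum formula. For \<open>i = j = 0\<close> both frequencies vanish, which is
  why \<open>cos_weight 0\<close> is twice the other weights.\<close>

lemma has_integral_cos_cos:
  fixes \<theta> \<theta>' :: "real \<Rightarrow> real" and i j :: nat
  assumes "0 \<le> a" "\<And>x. (\<theta> has_real_derivative \<theta>' x) (at x)" "\<theta> 0 = 0" "\<theta> a = pi"
  shows "((\<lambda>x. \<theta>' x * (cos (real i * \<theta> x) * cos (real j * \<theta> x))) has_integral
            (if i = j then cos_weight i else 0)) {0..a}"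
proof -
  let ?I = "\<lambda>n::int. if n = 0 then pi else 0"
  have "((\<lambda>x. 1/2 * (\<theta>' x * cos (of_int (int i - int j) * \<theta> x) + \<theta>' x * cos (of_int (int i + int j) * \<theta> x)))
      has_integral (1/2 * (?I (int i - int j) + ?I (int i + int j)))) {0..a}"
    by (intro has_integral_mult_right has_integral_add has_integral_deriv_cos assms)
  moreover have "1/2 * (\<theta>' x * cos (of_int (int i - int j) * \<theta> x) + \<theta>' x * cos (of_int (int i + int j) * \<theta> x))
      = \<theta>' x * (cos (real i * \<theta> x) * cos (real j * \<theta> x))" for x
    by (simp add: algebra_simps cos_add cos_diff)
  moreover have "1/2 * (?I (int i - int j) + ?I (int i + int j)) = (if i = j then cos_weight i else 0)"
    by (auto simp: cos_weight_def)
  ultimately show ?thesis by simp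
qed

text \<open>The analogue for the derivatives of cos(j t), up to sign. Keeping the factors
  \<open>i\<close> and \<open>j\<close> inside yields the cosine weights multiplied by j^2, ready
  for a termwise comparison.\<close>

lemma has_integral_sin_sin:
  fixes \<theta> \<theta>' :: "real \<Rightarrow> real" and i j :: nat
  assumes "0 \<le> a" "\<And>x. (\<theta> has_real_derivative \<theta>' x) (at x)" "\<theta> 0 = 0" "\<theta> a = pi"
  shows "((\<lambda>x. \<theta>' x * ((real i * sin (real i * \<theta> x)) * (real j * sin (real j * \<theta> x)))) has_integral
            (if i = j then (real i)\<^sup>2 * cos_weight i else 0)) {0..a}"
proof -
  let ?I = "\<lambda>n::int. if n = 0 then pi else 0"
  have "((\<lambda>x. (real i * real j / 2) * (\<theta>' x * cos (of_int (int i - int j) * \<theta> x) - \<theta>' x * cos (of_int (int i + int j) * \<theta> x)))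
      has_integral ((real i * real j / 2) * (?I (int i - int j) - ?I (int i + int j)))) {0..a}"
    by (intro has_integral_mult_right has_integral_diff has_integral_deriv_cos assms)
  moreover have "(real i * real j / 2) * (\<theta>' x * cos (of_int (int i - int j) * \<theta> x) - \<theta>' x * cos (of_int (int i + int j) * \<theta> x))
      = \<theta>' x * ((real i * sin (real i * \<theta> x)) * (real j * sin (real j * \<theta> x)))" for x
    by (simp add: algebra_simps cos_add cos_diff)
  moreover have "(real i * real j / 2) * (?I (int i - int j) - ?I (int i + int j))
      = (if i = j then (real i)\<^sup>2 * cos_weight i else 0)"
    by (auto simp: cos_weight_def power2_eq_square)
  ultimately show ?thesis by (simp only:)
qed

text \<open>Parseval for a finite orthogonal family: only the diagonal of the expanded square
  survives.\<close>

lemma has_integral_square_sum_orthogonal: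
  fixes f :: "nat \<Rightarrow> real \<Rightarrow> real"
  assumes "\<And>i j. ((\<lambda>x. g x * (f i x * f j x)) has_integral (if i = j then w i else 0)) S"
  shows "((\<lambda>x. g x * (\<Sum>j\<le>k. c j * f j x)\<^sup>2) has_integral (\<Sum>j\<le>k. w j * (c j)\<^sup>2)) S"
proof -
  have "((\<lambda>x. \<Sum>i\<le>k. \<Sum>j\<le>k. (c i * c j) * (g x * (f i x * f j x))) has_integral
      (\<Sum>i\<le>k. \<Sum>j\<le>k. (c i * c j) * (if i = j then w i else 0))) S"
    by (intro has_integral_sum has_integral_mult_right assms) auto
  moreover have "(\<Sum>i\<le>k. \<Sum>j\<le>k. (c i * c j) * (g x * (f i x * f j x)))
      = g x * (\<Sum>j\<le>k. c j * f j x)\<^sup>2" for x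
    by (simp add: power2_eq_square sum_product sum_distrib_left mult_ac)
  moreover have "(\<Sum>i\<le>k. \<Sum>j\<le>k. (c i * c j) * (if i = j then w i else 0)) = (\<Sum>j\<le>k. w j * (c j)\<^sup>2)"
    by (simp add: power2_eq_square mult_ac if_distrib cong: if_cong)
  ultimately show ?thesis by simp
qed

text \<open>Cauchy-Schwarz over \<open>k + 1\<close> terms, combined with
  \<open>1 \<le> 2 / pi * cos_weight j\<close>. The sum on the right is the integral of the squared
  cosine sum over [0, pi], so the L2 norm controls the sup norm.\<close>

lemma cos_sum_square_le:
  "(\<Sum>j\<le>k. c j * cos (real j * t))\<^sup>2 \<le> 2 * (real k + 1) / pi * (\<Sum>j\<le>k. cos_weight j * (c j)\<^sup>2)"
proof -
  have "(\<Sum>j\<le>k. c j * cos (real j * t))\<^sup>2 \<le> (\<Sum>j\<le>k. (c j * cos (real j * t))\<^sup>2) * real (card {..k})"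
    by (rule sum_squared_le_sum_of_squares)
  also have "(\<Sum>j\<le>k. (c j * cos (real j * t))\<^sup>2) \<le> (\<Sum>j\<le>k. 2 / pi * (cos_weight j * (c j)\<^sup>2))"
  proof (rule sum_mono)
    fix j
    have "(c j * cos (real j * t))\<^sup>2 \<le> (c j)\<^sup>2 * 1"
      unfolding power_mult_distrib
      by (intro mult_left_mono) (auto simp: abs_square_le_1)
    also have "\<dots> \<le> 2 / pi * (cos_weight j * (c j)\<^sup>2)"
      by (auto simp: cos_weight_def field_simps)
    finally show "(c j * cos (real j * t))\<^sup>2 \<le> 2 / pi * (cos_weight j * (c j)\<^sup>2)" .
  qed
  also have "(\<Sum>j\<le>k. 2 / pi * (cos_weight j * (c j)\<^sup>2)) * real (card {..k})
      = 2 * (real k + 1) / pi * (\<Sum>j\<le>k. cos_weight j * (c j)\<^sup>2)"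
    unfolding sum_distrib_left[symmetric] by simp
  finally show ?thesis by simp
qed

subsection \<open>Approximation by polynomials\<close>

text \<open>A measurable function is an a.e. limit of continuous ones. Clamping these to [0, 1]
  allows dominated convergence on [0, a], and Stone-Weierstrass replaces one of them by a
  polynomial.\<close>

lemma real_polynomial_L1_approx:
  fixes f :: "real \<Rightarrow> real"
  assumes f: "f \<in> borel_measurable lebesgue" "\<And>x. 0 \<le> f x" "\<And>x. f x \<le> 1" and "a > 0" "\<eta> > 0"
  obtains p where "real_polynomial_function p" "\<And>x. x \<in> {0..a} \<Longrightarrow> 0 \<le> p x \<and> p x \<le> 1"
    "(LINT x|lebesgue. indicator {0..a} x * \<bar>p x - f x\<bar>) \<le> \<eta>"
proof -
  have "f measurable_on UNIV"
    by (rule lebesgue_measurable_imp_measurable_on_real) (use f in auto)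
  then obtain N g where N: "negligible N" and g: "\<And>n. continuous_on UNIV (g n)"
    and lim: "\<And>x. x \<notin> N \<Longrightarrow> (\<lambda>n. g n x) \<longlonglongrightarrow> f x"
    unfolding measurable_on_def by auto
  define h where "h n x = max 0 (min 1 (g n x))" for n x
  have h: "continuous_on UNIV (h n)" "0 \<le> h n x" "h n x \<le> 1" for n x
    unfolding h_def by (auto intro!: continuous_intros g)
  have hf1: "\<bar>h n x - f x\<bar> \<le> 1" for n x
    using h(2,3)[of n x] f(2,3)[of x] by linarith
  have hm: "h n \<in> borel_measurable lebesgue" for n
    using borel_measurable_continuous_onI[OF h(1)] by (simp add: measurable_completion)
  have hlim: "(\<lambda>n. h n x) \<longlonglongrightarrow> f x" if "x \<notin> N" for x
  proof -
    have "(\<lambda>n. h n x) \<longlonglongrightarrow> max 0 (min 1 (f x))"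
      unfolding h_def by (intro tendsto_intros lim that)
    then show ?thesis using f(2,3)[of x] by (simp add: max_def min_def)
  qed
  have int1: "integrable lebesgue (indicator {0..a} :: real \<Rightarrow> real)"
    by (simp add: emeasure_lborel_Icc_eq)
  have "(\<lambda>n. LINT x|lebesgue. indicator {0..a} x * \<bar>h n x - f x\<bar>) \<longlonglongrightarrow> (LINT x|(lebesgue::real measure). 0::real)"
  proof (rule integral_dominated_convergence[where w = "indicator {0..a}"])
    show "AE x in lebesgue. (\<lambda>n. indicator {0..a} x * \<bar>h n x - f x\<bar>) \<longlonglongrightarrow> 0"
    proof (rule AE_I')
      show "N \<in> null_sets lebesgue" using N by (simp add: negligible_iff_null_sets)
      show "{x \<in> space lebesgue. \<not> (\<lambda>n. indicator {0..a} x * \<bar>h n x - f x\<bar>) \<longlonglongrightarrow> 0} \<subseteq> N"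
      proof (safe, rule ccontr)
        fix x assume x: "x \<notin> N" "\<not> (\<lambda>n. indicator {0..a} x * \<bar>h n x - f x\<bar>) \<longlonglongrightarrow> 0"
        have "(\<lambda>n. indicator {0..a} x * \<bar>h n x - f x\<bar>) \<longlonglongrightarrow> indicator {0..a} x * \<bar>f x - f x\<bar>"
          by (intro tendsto_intros hlim x(1))
        with x(2) show False by simp
      qed
    qed
    show "AE x in lebesgue. norm (indicator {0..a} x * \<bar>h n x - f x\<bar>) \<le> indicator {0..a} x" for n
      using hf1 by (intro AE_I2) (auto simp: indicator_def)
  qed (use f hm int1 in \<open>auto\<close>)
  then have "eventually (\<lambda>n. (LINT x|lebesgue. indicator {0..a} x * \<bar>h n x - f x\<bar>) < \<eta> / 2) sequentially"
    using \<open>\<eta> > 0\<close> by (intro order_tendstoD) auto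
  then obtain n where n: "(LINT x|lebesgue. indicator {0..a} x * \<bar>h n x - f x\<bar>) < \<eta> / 2"
    by (auto simp: eventually_sequentially)
  \<comment> \<open>Two uniform errors \<epsilon>, one from Stone-Weierstrass and one from the
    rescaling below, cost \<open>2 * \<epsilon> * a = \<eta> / 2\<close> in L1.\<close>
  define \<epsilon> where "\<epsilon> = \<eta> / (4 * a)"
  have \<epsilon>: "\<epsilon> > 0" using assms by (simp add: \<epsilon>_def)
  obtain q where q: "real_polynomial_function q" "\<And>x. x \<in> {0..a} \<Longrightarrow> \<bar>h n x - q x\<bar> < \<epsilon>"
    using Stone_Weierstrass_real_polynomial_function[OF compact_Icc continuous_on_subset[OF h(1) subset_UNIV] \<epsilon>]
    by metis
  \<comment> \<open>The affine map of [-\<epsilon>, 1 + \<epsilon>] onto [0, 1] restores the range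
    constraint and moves values in that interval by at most \<epsilon>.\<close>
  define p where "p x = (1 / (1 + 2 * \<epsilon>)) * (q x + \<epsilon>)" for x
  have p: "real_polynomial_function p"
    unfolding p_def by (intro real_polynomial_function.intros q(1))
  have qb: "- \<epsilon> \<le> q x \<and> q x \<le> 1 + \<epsilon>" if "x \<in> {0..a}" for x
    using q(2)[OF that] h(2,3)[of n x] by linarith
  have pq: "\<bar>p x - q x\<bar> \<le> \<epsilon>" if "x \<in> {0..a}" for x
  proof -
    have "p x - q x = \<epsilon> / (1 + 2 * \<epsilon>) * (1 - 2 * q x)"
      using \<epsilon> by (simp add: p_def field_simps)
    also have "\<bar>\<dots>\<bar> = \<epsilon> / (1 + 2 * \<epsilon>) * \<bar>1 - 2 * q x\<bar>"
      using \<epsilon> by (simp add: abs_mult)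
    also have "\<dots> \<le> \<epsilon> / (1 + 2 * \<epsilon>) * (1 + 2 * \<epsilon>)"
      using \<epsilon> qb[OF that] by (intro mult_left_mono) auto
    finally show ?thesis using \<epsilon> by simp
  qed
  show thesis
  proof (rule that[OF p])
    show "0 \<le> p x \<and> p x \<le> 1" if "x \<in> {0..a}" for x
      using qb[OF that] \<epsilon> by (auto simp: p_def field_simps)
    have i2: "integrable lebesgue (\<lambda>x. indicator {0..a} x * \<bar>h n x - f x\<bar>)"
    proof (rule Bochner_Integration.integrable_bound[OF int1])
      show "AE x in lebesgue. norm (indicator {0..a} x * \<bar>h n x - f x\<bar>) \<le> norm (indicator {0..a} x :: real)"
        using hf1 by (intro AE_I2) (auto simp: indicator_def)
    qed (use f(1) hm int1 in auto)
    have "(LINT x|lebesgue. indicator {0..a} x * \<bar>p x - f x\<bar>) \<le>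
        (LINT x|lebesgue. indicator {0..a} x * \<bar>h n x - f x\<bar> + 2 * \<epsilon> * indicator {0..a} x)"
    proof (rule integral_mono')
      show "integrable lebesgue (\<lambda>x. indicator {0..a} x * \<bar>h n x - f x\<bar> + 2 * \<epsilon> * indicator {0..a} x)"
        using i2 int1 by (intro Bochner_Integration.integrable_add) auto
      show "indicator {0..a} x * \<bar>p x - f x\<bar> \<le> indicator {0..a} x * \<bar>h n x - f x\<bar> + 2 * \<epsilon> * indicator {0..a} x" for x
        using pq[of x] q(2)[of x] by (auto simp: indicator_def)
    qed (use \<epsilon> in \<open>auto simp: indicator_def\<close>)
    also have "\<dots> = (LINT x|lebesgue. indicator {0..a} x * \<bar>h n x - f x\<bar>) + 2 * \<epsilon> * a"
      using i2 int1 \<open>a > 0\<close> by (subst Bochner_Integration.integral_add) auto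
    also have "\<dots> \<le> \<eta>"
      using n \<open>a > 0\<close> by (simp add: \<epsilon>_def field_simps)
    finally show "(LINT x|lebesgue. indicator {0..a} x * \<bar>p x - f x\<bar>) \<le> \<eta>" .
  qed
qed

lemma real_polynomial_function_antiderivative:
  fixes p :: "real \<Rightarrow> real"
  assumes "real_polynomial_function p"
  obtains P where "P 0 = 0" "\<And>x. (P has_real_derivative p x) (at x)"
proof -
  obtain c n where p: "p = (\<lambda>x. \<Sum>i\<le>n. c i * x ^ i)"
    using assms real_polynomial_function_iff_sum by metis
  show thesis
  proof (rule that[of "\<lambda>x. \<Sum>i\<le>n. c i / real (Suc i) * x ^ Suc i"])
    show "((\<lambda>x. \<Sum>i\<le>n. c i / real (Suc i) * x ^ Suc i) has_real_derivative p x) (at x)" for x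
    proof -
      have "((\<lambda>x. c i / real (Suc i) * x ^ Suc i) has_real_derivative c i * x ^ i) (at x)" for i
        using DERIV_cmult[OF DERIV_power[OF DERIV_ident, of "Suc i" x UNIV], of "c i / real (Suc i)"]
        by (simp del: of_nat_Suc)
      then show ?thesis unfolding p by (intro DERIV_sum)
    qed
  qed simp
qed

subsection \<open>Trial spaces\<close>

text \<open>Independence of the indexed family gives injectivity too, so the image has
  \<open>k + 1\<close> elements. This serves both the trial space and its restriction to the set
  where the density is positive.\<close>

lemma dim_span_image_atMost:
  fixes u :: "nat \<Rightarrow> 'v::real_vector"
  assumes "\<And>c. (\<Sum>j\<le>k. c j *\<^sub>R u j) = 0 \<Longrightarrow> \<forall>j\<le>k. c j = 0"
  shows "dim (span (u ` {..k})) = k + 1"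
proof -
  have inj: "inj_on u {..k}"
  proof (rule inj_onI, rule ccontr)
    fix i j assume ij: "i \<in> {..k}" "j \<in> {..k}" "u i = u j" "i \<noteq> j"
    \<comment> \<open>The difference of the i-th and j-th unit coefficient vectors is a nontrivial
      relation if \<open>u i = u j\<close>.\<close>
    have "(\<Sum>l\<le>k. ((if l = i then 1 else 0) - (if l = j then 1 else 0)) *\<^sub>R u l) = 0"
      using ij by (simp add: scaleR_diff_left sum_subtractf if_distrib[of "\<lambda>c. c *\<^sub>R _"] cong: if_cong)
    from assms[OF this] ij show False by auto
  qed
  have "independent (u ` {..k})"
  proof
    assume "dependent (u ` {..k})"
    then obtain d v where v: "v \<in> u ` {..k}" "d v \<noteq> 0" "(\<Sum>v\<in>u ` {..k}. d v *\<^sub>R v) = 0"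
      by (auto simp: dependent_finite)
    then have "(\<Sum>j\<le>k. d (u j) *\<^sub>R u j) = 0"
      using inj by (simp add: sum.reindex)
    from assms[OF this] v show False by auto
  qed
  then show ?thesis
    using inj by (simp add: dim_eq_card_independent card_image)
qed

lemma sum_fun_apply: "(\<Sum>i\<in>A. f i) x = (\<Sum>i\<in>A. f i x)"
  for f :: "'i \<Rightarrow> 'a \<Rightarrow> 'b::comm_monoid_add"
  by (induction A rule: infinite_finite_induct) simp_all

lemma linear_ae_class_mult: "linear (\<lambda>u. ae_class (\<lambda>x. u x * w x))"
proof (rule linearI)
  show "ae_class (\<lambda>x. (u + v) x * w x) = ae_class (\<lambda>x. u x * w x) + ae_class (\<lambda>x. v x * w x)" for u v
    by (simp add: plus_ae_fun.abs_eq plus_fun_def distrib_right)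
  show "ae_class (\<lambda>x. (r *\<^sub>R u) x * w x) = r *\<^sub>R ae_class (\<lambda>x. u x * w x)" for r u
    by (simp add: scaleR_ae_fun.abs_eq scaleR_fun_def mult.assoc)
qed

lemma ae_class_eq_0_iff: "ae_class f = 0 \<longleftrightarrow> (AE x in lebesgue. f x = 0)"
  by (simp add: zero_ae_fun_def ae_fun.abs_eq_iff ae_equal_def)

lemma smooth_in_test_functions:
  assumes "smooth f" "\<And>x. x \<notin> {a..b} \<Longrightarrow> f x = 0"
  shows "f \<in> test_functions"
proof -
  have "closure {x. f x \<noteq> 0} \<subseteq> {a..b}"
    using assms(2) by (intro closure_minimal subsetI) (blast, simp)
  then have "compact (closure {x. f x \<noteq> 0})"
    by (meson bounded_closed_interval bounded_subset closed_closure compact_eq_bounded_closed)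
  then show ?thesis
    using smooth_imp_deriv_differentiable[OF assms(1)] by (simp add: test_functions_def)
qed

text \<open>Moves gauge integrals over [0, a], to which the fundamental theorem applies, to Lebesgue
  integrals over the line, the form used in \<open>rayleigh\<close>.\<close>

lemma has_bochner_integral_indicator_continuous:
  fixes f :: "real \<Rightarrow> real"
  assumes "continuous_on UNIV f" "(f has_integral I) {0..a}"
  shows "has_bochner_integral lebesgue (\<lambda>x. indicator {0..a} x * f x) I"
proof -
  have s: "set_integrable lebesgue {0..a} f"
    using absolutely_integrable_continuous_real[OF continuous_on_subset[OF assms(1)]] by auto
  then have "(LINT x:{0..a}|lebesgue. f x) = I"
    using set_lebesgue_integral_eq_integral(2)[OF s] assms(2) by (simp add: integral_unique)
  with s show ?thesis
    by (simp add: has_bochner_integral_iff set_integrable_def set_lebesgue_integral_def)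
qed

subsection \<open>The eigenvalue bound\<close>

text \<open>Let I be the integral of V^2 over [0, pi]. On the trial space built from
  \<open>g\<close>, the numerator is at most (pi / M) k^2 I and the denominator at least I (M - 2 (k
  + 1) \<eta>) / pi; the bound is their ratio.\<close>

lemma mu_le_of_polynomial_density:
  fixes a \<eta> M :: real and F1 F2 g :: "real \<Rightarrow> real" and k :: nat
  assumes a: "a > 0" and "\<eta> > 0"
    and F1: "\<And>x. 0 \<le> F1 x" "\<And>x. F1 x \<le> 1" "\<And>x. x \<notin> {0<..<a} \<Longrightarrow> F1 x = 0"
    and F2: "\<And>x. 0 \<le> F2 x" "\<And>x. F2 x \<le> 1" "\<And>x. F2 x > 0 \<longleftrightarrow> x \<in> {0<..<a}"
      "F2 \<in> borel_measurable lebesgue"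
    and g: "real_polynomial_function g" "\<And>x. x \<in> {0..a} \<Longrightarrow> 0 \<le> g x \<and> g x \<le> 1"
    and gF2: "(LINT x|lebesgue. indicator {0..a} x * \<bar>g x - F2 x\<bar>) \<le> \<eta>"
    and M: "(g has_integral M) {0..a}" "2 * (real k + 1) * \<eta> < M"
  shows "mu k F1 F2 \<le> ereal (pi\<^sup>2 * (real k)\<^sup>2 / (M * (M - 2 * (real k + 1) * \<eta>)))"
proof -
  have "0 \<le> 2 * (real k + 1) * \<eta>" using \<open>\<eta> > 0\<close> by simp
  with M have Mpos: "M > 0" by linarith

  \<comment> \<open>Change of variable and integrals of the trial functions\<close>
  obtain P where P: "P 0 = 0" "\<And>x. (P has_real_derivative g x) (at x)"
    using real_polynomial_function_antiderivative[OF g(1)] by metis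
  have "(g has_integral (P a - P 0)) {0..a}"
    by (rule fundamental_theorem_of_calculus)
       (use a P in \<open>auto simp: has_real_derivative_iff_has_vector_derivative
          intro: has_vector_derivative_at_within\<close>)
  then have Pa: "P a = M" using M(1) P(1) by (auto dest: has_integral_unique)
  \<comment> \<open>Since \<open>P a = M\<close>, this factor makes \<theta> end at pi.\<close>
  define r where "r = pi / M"
  have r: "r > 0" using Mpos by (simp add: r_def)
  define \<theta> where "\<theta> x = r * P x" for x
  have "(\<theta> has_real_derivative r * g x) (at x)" for x
    unfolding \<theta>_def by (rule DERIV_cmult[OF P(2)])
  moreover have "\<theta> 0 = 0" "\<theta> a = pi"
    using P(1) Pa Mpos by (simp_all add: \<theta>_def r_def)
  ultimately have \<theta>: "(\<theta> has_real_derivative r * g x) (at x)" "\<theta> 0 = 0" "\<theta> a = pi" for x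
    by auto
  have gcont: "continuous_on UNIV g"
    using g(1) by (intro continuous_on_polymonial_function) (simp add: real_polynomial_function_eq)
  have \<theta>cont: "continuous_on UNIV \<theta>"
    using \<theta>(1) by (auto intro!: continuous_at_imp_continuous_on DERIV_isCont)
  obtain w where w: "smooth w" "\<And>x. x \<in> {0..a} \<Longrightarrow> w x = 1" "\<And>x. x \<notin> {0 - 1..a + 1} \<Longrightarrow> w x = 0"
    using smooth_cutoff[of 0 a] by metis
  define u where "u j x = w x * cos (real j * \<theta> x)" for j x
  \<comment> \<open>\<open>W c\<close> is minus the derivative of \<open>V c\<close>;
    \<open>I c\<close> and \<open>D c\<close> are the integrals of their squares over [0, pi],
    evaluated by orthogonality.\<close>
  define V where "V c t = (\<Sum>j\<le>k. c j * cos (real j * t))" for c t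
  define W where "W c t = (\<Sum>j\<le>k. c j * (real j * sin (real j * t)))" for c t
  define I where "I c = (\<Sum>j\<le>k. cos_weight j * (c j)\<^sup>2)" for c
  define D where "D c = (\<Sum>j\<le>k. ((real j)\<^sup>2 * cos_weight j) * (c j)\<^sup>2)" for c
  have Ucont: "continuous_on UNIV (\<lambda>x. V c (\<theta> x))" "continuous_on UNIV (\<lambda>x. W c (\<theta> x))" for c
    unfolding V_def W_def by (intro continuous_intros \<theta>cont)+
  have intV: "has_bochner_integral lebesgue (\<lambda>x. indicator {0..a} x * (r * g x * (V c (\<theta> x))\<^sup>2)) (I c)" for c
  proof (rule has_bochner_integral_indicator_continuous)
    show "((\<lambda>x. r * g x * (V c (\<theta> x))\<^sup>2) has_integral I c) {0..a}"
      unfolding V_def I_def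
      by (rule has_integral_square_sum_orthogonal, rule has_integral_cos_cos) (use a \<theta> in auto)
  qed (intro continuous_intros gcont Ucont)
  have intW: "has_bochner_integral lebesgue (\<lambda>x. indicator {0..a} x * (r * g x * (W c (\<theta> x))\<^sup>2)) (D c)" for c
  proof (rule has_bochner_integral_indicator_continuous)
    show "((\<lambda>x. r * g x * (W c (\<theta> x))\<^sup>2) has_integral D c) {0..a}"
      unfolding W_def D_def
      by (rule has_integral_square_sum_orthogonal, rule has_integral_sin_sin) (use a \<theta> in auto)
  qed (intro continuous_intros gcont Ucont)
  have D_le: "D c \<le> (real k)\<^sup>2 * I c" for c
    unfolding D_def I_def sum_distrib_left
    unfolding mult.assoc using cos_weight_pos[THEN less_imp_le]
    by (intro sum_mono mult_right_mono power_mono mult_nonneg_nonneg) auto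
  have I_zero: "\<forall>j\<le>k. c j = 0" if "I c = 0" for c
  proof -
    have "\<forall>j\<in>{..k}. cos_weight j * (c j)\<^sup>2 = 0"
      using that cos_weight_pos less_imp_le unfolding I_def
      by (subst sum_nonneg_eq_0_iff[symmetric]) (auto intro!: mult_nonneg_nonneg)
    then show ?thesis using cos_weight_pos by (metis atMost_iff mult_eq_0_iff power_eq_0_iff less_irrefl)
  qed
  have I_nonneg: "I c \<ge> 0" for c
    unfolding I_def using cos_weight_pos by (intro sum_nonneg mult_nonneg_nonneg) (auto simp: less_imp_le)
  have comb: "(\<Sum>j\<le>k. c j *\<^sub>R u j) x = w x * V c (\<theta> x)" for c x
    by (simp add: sum_fun_apply u_def V_def sum_distrib_left mult_ac)

  \<comment> \<open>Admissibility of the trial space\<close>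
  define T where "T v = ae_class (\<lambda>x. v x * indicator {x. F2 x > 0} x)" for v :: "real \<Rightarrow> real"
  have linT: "linear T" unfolding T_def by (rule linear_ae_class_mult)
  \<comment> \<open>If the combination vanishes a.e. where \<open>F2\<close> is positive, that is on
    (0, a), then so does \<open>V c (\<theta> x)\<close>, because \<open>w\<close> is 1 there. Hence
    \<open>I c = 0\<close>, and the positive weights force all coefficients to vanish.\<close>
  have indepT: "\<forall>j\<le>k. c j = 0" if "(\<Sum>j\<le>k. c j *\<^sub>R T (u j)) = 0" for c
  proof -
    have "T (\<Sum>j\<le>k. c j *\<^sub>R u j) = 0"
      using that by (simp add: linear_sum[OF linT] linear_scale[OF linT])
    then have "AE x in lebesgue. (\<Sum>j\<le>k. c j *\<^sub>R u j) x * indicator {x. F2 x > 0} x = (0::real)"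
      unfolding T_def ae_class_eq_0_iff .
    moreover have "AE x in lebesgue. x \<notin> {0, a}"
      by (rule AE_not_in) (simp add: negligible_iff_null_sets[symmetric])
    ultimately have "AE x in lebesgue. indicator {0..a} x * (r * g x * (V c (\<theta> x))\<^sup>2) = 0"
    proof eventually_elim
      case (elim x)
      then show ?case using w(2)[of x] F2(3)[of x] by (auto simp: comb indicator_def split: if_splits)
    qed
    then have "(LINT x|lebesgue. indicator {0..a} x * (r * g x * (V c (\<theta> x))\<^sup>2)) = 0"
      by (rule integral_eq_zero_AE)
    with intV[of c] have "I c = 0" by (simp add: has_bochner_integral_iff)
    then show ?thesis by (rule I_zero)
  qed
  define S where "S = span (u ` {..k})"
  have "dim S = k + 1"
    unfolding S_def
  proof (rule dim_span_image_atMost)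
    fix c assume "(\<Sum>j\<le>k. c j *\<^sub>R u j) = 0"
    \<comment> \<open>Independence of the \<open>u j\<close> themselves is inherited from their
      images under the linear map \<open>T\<close>.\<close>
    then have "T (\<Sum>j\<le>k. c j *\<^sub>R u j) = 0" using linear_0[OF linT] by simp
    then show "\<forall>j\<le>k. c j = 0"
      by (intro indepT) (simp add: linear_sum[OF linT] linear_scale[OF linT])
  qed
  moreover have "dim (T ` S) = k + 1"
  proof -
    have "T ` S = span ((\<lambda>j. T (u j)) ` {..k})"
      unfolding S_def by (simp add: linear_span_image[OF linT, symmetric] image_image)
    then show ?thesis using dim_span_image_atMost[where k = k and u = "\<lambda>j. T (u j)"] indepT by simp
  qed
  moreover have S_elem: "\<exists>c. v = (\<lambda>x. w x * V c (\<theta> x))" if "v \<in> S" for v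
    using that unfolding S_def
  proof (induction rule: span_induct_alt)
    case base
    show ?case by (intro exI[of _ "\<lambda>_. 0"]) (simp add: V_def fun_eq_iff)
  next
    case (step q x y)
    then obtain c j where c: "y = (\<lambda>x. w x * V c (\<theta> x))" and j: "j \<le> k" "x = u j" by auto
    \<comment> \<open>Adding \<open>q\<close> times \<open>u j\<close> changes only the j-th
      coefficient.\<close>
    define d where "d = c(j := c j + q)"
    have "V d t = V c t + q * cos (real j * t)" for t
    proof -
      have "V d t = (\<Sum>i\<le>k. c i * cos (real i * t) + (if i = j then q * cos (real j * t) else 0))"
        unfolding V_def d_def by (intro sum.cong) (auto simp: algebra_simps)
      then show ?thesis using j by (simp add: sum.distrib V_def)
    qed
    then show ?case
      by (intro exI[of _ d]) (simp add: c j u_def fun_eq_iff algebra_simps)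
  qed
  moreover have "S \<subseteq> test_functions"
  proof
    fix v assume "v \<in> S"
    then obtain c where v: "v = (\<lambda>x. w x * V c (\<theta> x))" using S_elem by blast
    \<comment> \<open>The derivative of \<theta> is a polynomial. Proving order \<open>Suc n\<close>
      and then lowering it avoids a case distinction on \<open>n\<close>.\<close>
    have \<theta>n: "ndiff n \<theta>" for n
      by (rule ndiff_Suc_imp, rule ndiff_SucI[OF \<theta>(1)])
         (intro ndiff_mult ndiff_const ndiff_real_polynomial_function g(1))
    have "ndiff n (\<lambda>x. \<Sum>j\<le>l. c j * cos (real j * \<theta> x))" for n l
      by (induction l)
         (auto intro!: ndiff_add ndiff_mult ndiff_const ndiff_compose[OF ndiff_cos_sin(1)] \<theta>n)
    then have "smooth v"
      using w(1) unfolding smooth_def v V_def by (auto intro!: ndiff_mult)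
    then show "v \<in> test_functions"
      by (rule smooth_in_test_functions[of _ "0 - 1" "a + 1"]) (simp add: v w(3))
  qed
  ultimately have adm: "S \<in> admissible k F2"
    unfolding admissible_def T_def by (auto simp: S_def)

  \<comment> \<open>The Rayleigh quotient on the trial space\<close>
  let ?b = "pi\<^sup>2 * (real k)\<^sup>2 / (M * (M - 2 * (real k + 1) * \<eta>))"
  have "rayleigh F1 F2 v \<le> ?b" if v: "v \<in> S - {0}" for v
  proof -
    obtain c where c: "v = (\<lambda>x. w x * V c (\<theta> x))" using S_elem v by blast
    have "I c \<noteq> 0"
    proof
      assume "I c = 0"
      from I_zero[OF this] have "v = 0" unfolding c V_def by (simp add: fun_eq_iff)
      with v show False by simp
    qed
    with I_nonneg[of c] have Ipos: "I c > 0" by linarith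
    \<comment> \<open>On the open interval \<open>w\<close> is 1 near each point, so its derivative
      does not enter; elsewhere \<open>F1\<close> vanishes.\<close>
    have dv: "deriv v x = - (r * g x * W c (\<theta> x))" if "x \<in> {0<..<a}" for x
    proof -
      have "((\<lambda>x. V c (\<theta> x)) has_real_derivative - (r * g x * W c (\<theta> x))) (at x)"
        unfolding V_def W_def sum_distrib_left sum_negf[symmetric]
        by (rule DERIV_sum) (auto intro!: derivative_eq_intros \<theta>(1))
      then have "(v has_real_derivative - (r * g x * W c (\<theta> x))) (at x)"
        by (rule has_field_derivative_transform_within_open[of _ _ _ "{0<..<a}"])
           (use that in \<open>auto simp: c w(2)\<close>)
      then show ?thesis by (rule DERIV_imp_deriv)
    qed
    have "(LINT x|lebesgue. F1 x * (deriv v x)\<^sup>2) \<le>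
        (LINT x|lebesgue. r * (indicator {0..a} x * (r * g x * (W c (\<theta> x))\<^sup>2)))"
    \<comment> \<open>Only the majorant is shown integrable. Should the left integrand fail to be,
      its integral is 0 by convention and the bound holds since the majorant is nonnegative.\<close>
    proof (rule integral_mono')
      show "integrable lebesgue (\<lambda>x. r * (indicator {0..a} x * (r * g x * (W c (\<theta> x))\<^sup>2)))"
        using intW[of c] by (simp add: has_bochner_integral_iff)
      show nn: "0 \<le> r * (indicator {0..a} x * (r * g x * (W c (\<theta> x))\<^sup>2))" for x
        using r g(2)[of x] by (auto simp: indicator_def)
      show "F1 x * (deriv v x)\<^sup>2 \<le> r * (indicator {0..a} x * (r * g x * (W c (\<theta> x))\<^sup>2))" for x
      proof (cases "x \<in> {0<..<a}")
        case True
        then have gx: "0 \<le> g x" "g x \<le> 1" using g(2)[of x] by auto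
        have "F1 x * (deriv v x)\<^sup>2 \<le> 1 * (deriv v x)\<^sup>2"
          using F1(2) by (intro mult_right_mono) auto
        also have "\<dots> = (g x * g x) * (r\<^sup>2 * (W c (\<theta> x))\<^sup>2)"
          using dv[OF True] by (simp add: power2_eq_square mult_ac)
        \<comment> \<open>Here \<open>g x \<le> 1\<close> lowers g^2 to g, leaving the weight
          \<open>r * g x\<close> against which W^2 integrates to \<open>D c\<close>.\<close>
        also have "\<dots> \<le> (g x * 1) * (r\<^sup>2 * (W c (\<theta> x))\<^sup>2)"
          using gx by (intro mult_right_mono mult_left_mono) auto
        finally show ?thesis using True by (simp add: power2_eq_square mult_ac)
      next
        case False
        then show ?thesis using F1(3) nn by simp
      qed
    qed
    also have "\<dots> = r * D c"
      using intW[of c] by (simp add: has_bochner_integral_iff)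
    also have "\<dots> \<le> r * ((real k)\<^sup>2 * I c)"
      using D_le r by (intro mult_left_mono) auto
    finally have num: "(LINT x|lebesgue. F1 x * (deriv v x)\<^sup>2) \<le> r * ((real k)\<^sup>2 * I c)" .
    define B where "B = 2 * (real k + 1) / pi * I c"
    have B: "(V c t)\<^sup>2 \<le> B" for t unfolding V_def B_def I_def by (rule cos_sum_square_le)
    have B0: "B \<ge> 0" using B[of 0] by (meson order_trans zero_le_power2)
    have hm: "(\<lambda>x. V c (\<theta> x)) \<in> borel_measurable lebesgue" "g \<in> borel_measurable lebesgue"
      using borel_measurable_continuous_onI[OF Ucont(1)] borel_measurable_continuous_onI[OF gcont]
      by (simp_all add: measurable_completion)
    have int1: "integrable lebesgue (indicator {0..a} :: real \<Rightarrow> real)"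
      by (simp add: emeasure_lborel_Icc_eq)
    have F2V: "F2 x * (v x)\<^sup>2 = indicator {0..a} x * (F2 x * (V c (\<theta> x))\<^sup>2)" for x
      using F2(1)[of x] F2(3)[of x] w(2)[of x] by (auto simp: c indicator_def)
    have i1: "integrable lebesgue (\<lambda>x. F2 x * (v x)\<^sup>2)"
      unfolding F2V
    proof (rule Bochner_Integration.integrable_bound[OF integrable_mult_right[OF int1, of B]])
      have "F2 x * (V c (\<theta> x))\<^sup>2 \<le> 1 * B" for x
        using F2(1,2)[of x] B[of "\<theta> x"] by (intro mult_mono) auto
      then show "AE x in lebesgue. norm (indicator {0..a} x * (F2 x * (V c (\<theta> x))\<^sup>2)) \<le> norm (B * indicator {0..a} x)"
        using F2(1) B0 by (intro AE_I2) (auto simp: indicator_def abs_mult)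
    qed (use F2(4) hm int1 in auto)
    have i2: "integrable lebesgue (\<lambda>x. indicator {0..a} x * \<bar>g x - F2 x\<bar>)"
    proof (rule Bochner_Integration.integrable_bound[OF int1])
      have "\<bar>g x - F2 x\<bar> \<le> 1" if "x \<in> {0..a}" for x
        using g(2)[OF that] F2(1,2)[of x] by linarith
      then show "AE x in lebesgue. norm (indicator {0..a} x * \<bar>g x - F2 x\<bar>) \<le> norm (indicator {0..a} x :: real)"
        by (intro AE_I2) (auto simp: indicator_def)
    qed (use F2(4) hm int1 in auto)
    have "I c \<le> (LINT x|lebesgue. r * (F2 x * (v x)\<^sup>2) + r * B * (indicator {0..a} x * \<bar>g x - F2 x\<bar>))"
    proof -
      have "I c = (LINT x|lebesgue. indicator {0..a} x * (r * g x * (V c (\<theta> x))\<^sup>2))"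
        using intV[of c] by (simp add: has_bochner_integral_iff)
      also have "\<dots> \<le> (LINT x|lebesgue. r * (F2 x * (v x)\<^sup>2) + r * B * (indicator {0..a} x * \<bar>g x - F2 x\<bar>))"
      proof (rule integral_mono)
        show "indicator {0..a} x * (r * g x * (V c (\<theta> x))\<^sup>2) \<le>
            r * (F2 x * (v x)\<^sup>2) + r * B * (indicator {0..a} x * \<bar>g x - F2 x\<bar>)" for x
        proof -
          \<comment> \<open>Exchanging \<open>g\<close> for \<open>F2\<close> costs at most their
            distance times the uniform bound \<open>B\<close> on V^2.\<close>
          have "(g x - F2 x) * (V c (\<theta> x))\<^sup>2 \<le> \<bar>g x - F2 x\<bar> * B"
            using B[of "\<theta> x"] by (intro mult_mono) auto
          then have "r * ((g x - F2 x) * (V c (\<theta> x))\<^sup>2) \<le> r * (\<bar>g x - F2 x\<bar> * B)"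
            using r by (intro mult_left_mono) auto
          then show ?thesis unfolding F2V by (auto simp: indicator_def algebra_simps)
        qed
      qed (use i1 i2 intV[of c] in \<open>auto simp: has_bochner_integral_iff\<close>)
      finally show ?thesis .
    qed
    also have "\<dots> = r * (LINT x|lebesgue. F2 x * (v x)\<^sup>2) + r * B * (LINT x|lebesgue. indicator {0..a} x * \<bar>g x - F2 x\<bar>)"
      using i1 i2 by (subst Bochner_Integration.integral_add) auto
    also have "\<dots> \<le> r * (LINT x|lebesgue. F2 x * (v x)\<^sup>2) + r * B * \<eta>"
      using gF2 r B0 by (intro add_left_mono mult_left_mono) auto
    finally have "I c - r * B * \<eta> \<le> r * (LINT x|lebesgue. F2 x * (v x)\<^sup>2)" by simp
    \<comment> \<open>By the choice of \<open>r\<close> and \<open>B\<close>, the factors pi cancel: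
      \<open>r * B = 2 * (real k + 1) * I c / M\<close>.\<close>
    moreover have "I c - r * B * \<eta> = I c * (M - 2 * (real k + 1) * \<eta>) / M"
      using Mpos by (simp add: r_def B_def field_simps)
    ultimately have "I c * (M - 2 * (real k + 1) * \<eta>) / M \<le> (pi * (LINT x|lebesgue. F2 x * (v x)\<^sup>2)) / M"
      by (simp add: r_def)
    then have "I c * (M - 2 * (real k + 1) * \<eta>) \<le> pi * (LINT x|lebesgue. F2 x * (v x)\<^sup>2)"
      using Mpos by (simp only: divide_le_cancel)
    then have den: "I c * (M - 2 * (real k + 1) * \<eta>) / pi \<le> (LINT x|lebesgue. F2 x * (v x)\<^sup>2)"
      by (simp add: pos_divide_le_eq mult.commute)
    have "rayleigh F1 F2 v \<le> (r * ((real k)\<^sup>2 * I c)) / (I c * (M - 2 * (real k + 1) * \<eta>) / pi)"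
      unfolding rayleigh_def
      by (rule frac_le[OF _ num _ den]) (use r Ipos M(2) in auto)
    also have "\<dots> = ?b"
    proof -
      have "(r * ((real k)\<^sup>2 * I c)) / (I c * E / pi) = pi\<^sup>2 * (real k)\<^sup>2 / (M * E)" if "E > 0" for E
        using Ipos Mpos that by (simp add: r_def field_simps power2_eq_square)
      then show ?thesis using M(2) by simp
    qed
    finally show ?thesis .
  qed
  then have "(SUP v \<in> S - {0}. ereal (rayleigh F1 F2 v)) \<le> ereal ?b"
    by (intro SUP_least) simp
  with adm show ?thesis
    unfolding mu_def by (rule INF_lower2)
qed

theorem lemma13:
  fixes a \<delta> m :: real and \<rho>1 \<rho>2 :: "real \<Rightarrow> real" and k :: nat
  assumes "a > 0" and "\<delta> > 0"
    and "\<rho>1 \<in> borel_measurable (lebesgue_on {0<..<a})"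
    and "\<rho>2 \<in> borel_measurable (lebesgue_on {0<..<a})"
    and "\<rho>1 \<in> {0<..<a} \<rightarrow> {\<delta>..1}" and "\<rho>2 \<in> {0<..<a} \<rightarrow> {\<delta>..1}"
    and "m = min (LINT x:{0<..<a}|lebesgue. \<rho>1 x) (LINT x:{0<..<a}|lebesgue. \<rho>2 x)"
  shows "mu k (zero_extend {0<..<a} \<rho>1) (zero_extend {0<..<a} \<rho>2)
           \<le> ereal (pi\<^sup>2 * (real k)\<^sup>2 / m\<^sup>2)"
proof -
  let ?J = "{0<..<a}"
  define F1 where "F1 = zero_extend ?J \<rho>1"
  define F2 where "F2 = zero_extend ?J \<rho>2"
  define M2 where "M2 = (LINT x|lebesgue. F2 x)"
  have \<rho>: "\<delta> \<le> \<rho>1 x \<and> \<rho>1 x \<le> 1" "\<delta> \<le> \<rho>2 x \<and> \<rho>2 x \<le> 1" if "x \<in> ?J" for x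
    using assms(5,6) that by fastforce+
  have F1: "0 \<le> F1 x" "F1 x \<le> 1" "x \<notin> ?J \<Longrightarrow> F1 x = 0" for x
    using assms(2) \<rho>(1)[of x] by (auto simp: F1_def zero_extend_def)
  have F2: "0 \<le> F2 x" "F2 x \<le> 1" "F2 x > 0 \<longleftrightarrow> x \<in> ?J" "\<delta> * indicator ?J x \<le> F2 x" for x
    using assms(2) \<rho>(2)[of x] by (auto simp: F2_def zero_extend_def)
  have F_meas: "F1 \<in> borel_measurable lebesgue" "F2 \<in> borel_measurable lebesgue"
    using assms(3,4) unfolding F1_def F2_def zero_extend_def by (auto intro!: borel_measurable_if_I simp del: greaterThanLessThan_iff)
  have int1: "integrable lebesgue (indicator {0..a} :: real \<Rightarrow> real)"
    "integrable lebesgue (indicator ?J :: real \<Rightarrow> real)"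
    using \<open>a > 0\<close> by simp_all
  have F_le: "F1 x \<le> indicator ?J x" "F2 x \<le> indicator ?J x" for x
    using \<rho>[of x] by (auto simp: F1_def F2_def zero_extend_def)
  have F_int: "integrable lebesgue F1" "integrable lebesgue F2"
    using F_le F1(1) F2(1) F_meas by (auto intro!: Bochner_Integration.integrable_bound[OF int1(2)] AE_I2)
  have LINT_F: "(LINT x:?J|lebesgue. \<rho> x) = (LINT x|lebesgue. zero_extend ?J \<rho> x)" for \<rho>
    unfolding set_lebesgue_integral_def zero_extend_def
    by (intro Bochner_Integration.integral_cong) (auto simp: indicator_def)
  \<comment> \<open>The lower bound \<delta> on the densities makes \<open>m\<close> at least
    \<open>\<delta> * a\<close>, hence positive, so the final quotient has a nonzero
    denominator.\<close>
  have ge: "\<delta> * a \<le> (LINT x|lebesgue. F x)"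
    if "integrable lebesgue F" "\<And>x. \<delta> * indicator ?J x \<le> F x" for F
    using integral_mono[of lebesgue "\<lambda>x. \<delta> * indicator ?J x" F] that int1(2) \<open>a > 0\<close> by simp
  have "\<delta> * indicator ?J x \<le> F1 x" for x
    using \<rho>(1)[of x] by (auto simp: F1_def zero_extend_def)
  then have "0 < m" "m \<le> M2"
    using ge[OF F_int(1)] ge[OF F_int(2) F2(4)] mult_pos_pos[OF assms(2,1)]
    unfolding assms(7) LINT_F F1_def[symmetric] F2_def[symmetric] M2_def by auto

  \<comment> \<open>Polynomial approximation and the limit of vanishing error\<close>
  define C where "C = 2 * (real k + 1)"
  have bound: "mu k F1 F2 \<le> ereal (pi\<^sup>2 * (real k)\<^sup>2 / ((m - \<eta>) * (m - \<eta> - C * \<eta>)))"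
    if \<eta>: "\<eta> > 0" "\<eta> + C * \<eta> < m" for \<eta>
  proof -
    obtain g where g: "real_polynomial_function g" "\<And>x. x \<in> {0..a} \<Longrightarrow> 0 \<le> g x \<and> g x \<le> 1"
      "(LINT x|lebesgue. indicator {0..a} x * \<bar>g x - F2 x\<bar>) \<le> \<eta>"
      using real_polynomial_L1_approx[OF F_meas(2) F2(1) F2(2) \<open>a > 0\<close> \<eta>(1)] by metis
    have gcont: "continuous_on UNIV g"
      using g(1) by (intro continuous_on_polymonial_function) (simp add: real_polynomial_function_eq)
    define M where "M = integral {0..a} g"
    have M: "(g has_integral M) {0..a}"
      unfolding M_def by (intro integrable_integral integrable_continuous_real continuous_on_subset[OF gcont]) auto
    have gint: "integrable lebesgue (\<lambda>x. indicator {0..a} x * g x)" "(LINT x|lebesgue. indicator {0..a} x * g x) = M"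
      using has_bochner_integral_indicator_continuous[OF gcont M] by (auto simp: has_bochner_integral_iff)
    have Fg: "F2 x = indicator {0..a} x * F2 x" for x
      using F2(1)[of x] F2(3)[of x] by (auto simp: indicator_def)
    \<comment> \<open>The L1 error bounds the loss of mass: \<open>M\<close> is at least
      \<open>M2 - \<eta>\<close>, and \<open>m \<le> M2\<close> then gives
      \<open>m - \<eta> \<le> M\<close>.\<close>
    have "M2 - M = (LINT x|lebesgue. F2 x - indicator {0..a} x * g x)"
      unfolding M2_def using gint F_int by simp
    also have "\<dots> \<le> (LINT x|lebesgue. indicator {0..a} x * \<bar>g x - F2 x\<bar>)"
    proof (rule integral_mono)
      have "integrable lebesgue (\<lambda>x. \<bar>indicator {0..a} x * g x - F2 x\<bar>)"
        using gint F_int by auto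
      moreover have eq: "\<bar>indicator {0..a} x * g x - F2 x\<bar> = indicator {0..a} x * \<bar>g x - F2 x\<bar>" for x
        using Fg[of x] by (auto simp: indicator_def)
      ultimately show "integrable lebesgue (\<lambda>x. indicator {0..a} x * \<bar>g x - F2 x\<bar>)" by simp
      show "F2 x - indicator {0..a} x * g x \<le> indicator {0..a} x * \<bar>g x - F2 x\<bar>" for x
        unfolding eq[symmetric] by simp
    qed (use gint F_int in auto)
    finally have "m - \<eta> \<le> M" using g(3) \<open>m \<le> M2\<close> by simp
    have "C * \<eta> \<ge> 0" using \<eta>(1) by (simp add: C_def)
    have "mu k F1 F2 \<le> ereal (pi\<^sup>2 * (real k)\<^sup>2 / (M * (M - C * \<eta>)))"
      unfolding C_def
      by (rule mu_le_of_polynomial_density[OF \<open>a > 0\<close> \<eta>(1) F1 F2(1-3) F_meas(2) g M])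
         (use \<eta>(2) \<open>m - \<eta> \<le> M\<close> in \<open>auto simp: C_def\<close>)
    \<comment> \<open>The quotient decreases in \<open>M\<close>; the condition
      \<open>\<eta> + C * \<eta> < m\<close> keeps both factors of the denominator positive.\<close>
    also have "\<dots> \<le> ereal (pi\<^sup>2 * (real k)\<^sup>2 / ((m - \<eta>) * (m - \<eta> - C * \<eta>)))"
      using \<eta> \<open>m - \<eta> \<le> M\<close> \<open>C * \<eta> \<ge> 0\<close>
      by (auto intro!: divide_left_mono mult_mono mult_pos_pos)
    finally show ?thesis .
  qed
  \<comment> \<open>\<open>mu k F1 F2\<close> is independent of \<eta>, so the bound passes to the
    limit from the right. The terms with 0 have the shape that \<open>tendsto_intros\<close>
    produces.\<close>
  have "((\<lambda>\<eta>. ereal (pi\<^sup>2 * (real k)\<^sup>2 / ((m - \<eta>) * (m - \<eta> - C * \<eta>)))) \<longlongrightarrow>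
      ereal (pi\<^sup>2 * (real k)\<^sup>2 / ((m - 0) * (m - 0 - C * 0)))) (at_right 0)"
    using \<open>0 < m\<close> by (intro tendsto_intros) auto
  moreover have "\<forall>\<^sub>F \<eta> in at_right 0. \<eta> + C * \<eta> < m"
  proof (rule order_tendstoD)
    show "((\<lambda>\<eta>. \<eta> + C * \<eta>) \<longlongrightarrow> 0 + C * 0) (at_right 0)" by (intro tendsto_intros)
  qed (use \<open>0 < m\<close> in simp)
  then have "\<forall>\<^sub>F \<eta> in at_right 0. mu k F1 F2 \<le> ereal (pi\<^sup>2 * (real k)\<^sup>2 / ((m - \<eta>) * (m - \<eta> - C * \<eta>)))"
    using eventually_at_right_less[of 0] by eventually_elim (rule bound)
  ultimately have "mu k F1 F2 \<le> ereal (pi\<^sup>2 * (real k)\<^sup>2 / ((m - 0) * (m - 0 - C * 0)))"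
    by (rule tendsto_lowerbound) simp
  then show ?thesis by (simp add: F1_def F2_def power2_eq_square)
qed

end
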